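(* Let $G=(V,E)$ be a finite connected edge-weighted graph with pairwise distinct positive edge weights $\{d_{ij} : (i,j)\in E\}$, and let $T^*(G)$ be its (unique) minimum spanning tree with respect to the weights $d_{ij}$. For $\alpha\in\mathbb{R}$ let $G_\alpha$ be the same graph with edge weights $d_{ij}^{1-\alpha}$, and let $G_\alpha^*$ be the geodesic sub-graph of $G_\alpha$. Then there exists $\alpha^*\in\mathbb{R}$ such that for every $\alpha\le\alpha^*$ the geodesic sub-graph $G^*_\alpha$ equals $T^*(G)$, endowed with the metric $d_\alpha$, and therefore $G^*_\alpha$ (as a metric graph with the metric $d_\alpha$) is a CAT(0) space.
   Context: For an edge-weighted graph with positive weights, the length of a path is the sum of the weights of its edges, and an edge geodesic between two vertices is a path of minimal length between them. The geodesic sub-graph of an edge-weighted graph is the sub-graph that is the union of all the edge geodesics between all pairs of vertices. The metric $d_\alpha$ on a graph with weights $d_{ij}$ is defined on all points of the graph (points in the interior of edges as well as vertices): each edge $(i,j)$ is identified with a segment of length $d_{ij}$ with line element $ds$, and for points $x,x'$ of the graph $$d_\alpha(x,x')=\inf_{\Gamma}\int_\Gamma w(s)\,ds,$$ the infimum being over paths $\Gamma$ in the graph from $x$ to $x'$, where $w(s)=d_{ij}^{-\alpha}$ when the line element lies in the edge $(i,j)$. Thus the edge $(i,j)$ has $d_\alpha$-length $d_{ij}^{1-\alpha}$. A geodesic metric space is CAT(0) if for every geodesic triangle with vertices $a,b,c$, every Euclidean comparison triangle $a',b',c'$ (same side lengths) and every point $x$ on the geodesic side from $b$ to $c$ with corresponding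 point $x'$ on the segment $b'c'$ ($d(b,x)=\|b'-x'\|$), one has $d(x,a)\le\|x'-a'\|$. *)

theory Defs
  imports "HOL-Analysis.Analysis"
begin

section \<open>Finite simple graphs and minimum spanning trees\<close>

type_synonym 'a graph = "'a set \<times> 'a set set"

abbreviation verts :: "'a graph \<Rightarrow> 'a set" where "verts G \<equiv> fst G"
abbreviation edges :: "'a graph \<Rightarrow> 'a set set" where "edges G \<equiv> snd G"

definition finite_graph :: "'a graph \<Rightarrow> bool" where
  "finite_graph G \<longleftrightarrow> finite (verts G) \<and>
     (\<forall>e\<in>edges G. \<exists>u\<in>verts G. \<exists>v\<in>verts G. u \<noteq> v \<and> e = {u, v})"

fun path_edges :: "'a list \<Rightarrow> 'a set list" where
  "path_edges (u # v # p) = {u, v} # path_edges (v # p)"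
| "path_edges p = []"

definition graph_path :: "'a graph \<Rightarrow> 'a \<Rightarrow> 'a list \<Rightarrow> 'a \<Rightarrow> bool" where
  "graph_path G u p v \<longleftrightarrow> p \<noteq> [] \<and> hd p = u \<and> last p = v \<and> distinct p \<and>
     set p \<subseteq> verts G \<and> set (path_edges p) \<subseteq> edges G"

definition connected_graph :: "'a graph \<Rightarrow> bool" where
  "connected_graph G \<longleftrightarrow> verts G \<noteq> {} \<and> (\<forall>u\<in>verts G. \<forall>v\<in>verts G. \<exists>p. graph_path G u p v)"

definition graph_cycle :: "'a graph \<Rightarrow> 'a list \<Rightarrow> bool" where
  "graph_cycle G p \<longleftrightarrow> length p \<ge> 3 \<and> graph_path G (hd p) p (last p) \<and> {last p, hd p} \<in> edges G"

definition tree_graph :: "'a graph \<Rightarrow> bool" where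
  "tree_graph T \<longleftrightarrow> finite_graph T \<and> connected_graph T \<and> (\<nexists>p. graph_cycle T p)"

definition spanning_tree :: "'a graph \<Rightarrow> 'a graph \<Rightarrow> bool" where
  "spanning_tree G T \<longleftrightarrow> tree_graph T \<and> verts T = verts G \<and> edges T \<subseteq> edges G"

definition minimum_spanning_tree :: "'a graph \<Rightarrow> ('a set \<Rightarrow> real) \<Rightarrow> 'a graph \<Rightarrow> bool" where
  "minimum_spanning_tree G d T \<longleftrightarrow> spanning_tree G T \<and>
     (\<forall>T'. spanning_tree G T' \<longrightarrow> sum d (edges T) \<le> sum d (edges T'))"

text \<open>Only meaningful when the minimum spanning tree is unique.\<close>

definition the_mst :: "'a graph \<Rightarrow> ('a set \<Rightarrow> real) \<Rightarrow> 'a graph" where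
  "the_mst G d = (THE T. minimum_spanning_tree G d T)"


section \<open>Edge geodesics and the geodesic sub-graph\<close>

definition path_weight :: "('a set \<Rightarrow> real) \<Rightarrow> 'a list \<Rightarrow> real" where
  "path_weight w p = sum_list (map w (path_edges p))"

definition edge_geodesic :: "'a graph \<Rightarrow> ('a set \<Rightarrow> real) \<Rightarrow> 'a \<Rightarrow> 'a list \<Rightarrow> 'a \<Rightarrow> bool" where
  "edge_geodesic G w u p v \<longleftrightarrow> graph_path G u p v \<and>
     (\<forall>q. graph_path G u q v \<longrightarrow> path_weight w p \<le> path_weight w q)"

definition geodesic_subgraph :: "'a graph \<Rightarrow> ('a set \<Rightarrow> real) \<Rightarrow> 'a graph" where
  "geodesic_subgraph G w =
     (\<Union>{set p | u p v. u \<in> verts G \<and> v \<in> verts G \<and> edge_geodesic G w u p v},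
      \<Union>{set (path_edges p) | u p v. u \<in> verts G \<and> v \<in> verts G \<and> edge_geodesic G w u p v})"


section \<open>The metric \<open>d\<^sub>\<alpha>\<close> on the points of a graph\<close>

text \<open>
  Points of a graph are given in barycentric coordinates: a vertex is the indicator function of
  itself, and a point of the edge \<open>{u, v}\<close> is a convex combination of its two endpoints. Thus
  edges are automatically glued along their common vertices.
\<close>

definition vertex_point :: "'a \<Rightarrow> 'a \<Rightarrow> real" where
  "vertex_point v = (\<lambda>u. if u = v then 1 else 0)"

definition edge_points :: "'a set \<Rightarrow> ('a \<Rightarrow> real) set" where
  "edge_points e = {x. (\<forall>v. 0 \<le> x v) \<and> (\<forall>v. v \<notin> e \<longrightarrow> x v = 0) \<and> (\<Sum>v\<in>e. x v) = 1}"

definition graph_points :: "'a graph \<Rightarrow> ('a \<Rightarrow> real) set" where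
  "graph_points G = vertex_point ` verts G \<union> (\<Union>e\<in>edges G. edge_points e)"

text \<open>
  The length of the segment between two points \<open>x\<close>, \<open>y\<close> of the edge \<open>e = {u, v}\<close>, when \<open>e\<close> is
  identified with a segment of length \<open>d e\<close>. The two summands \<open>\<bar>x u - y u\<bar>\<close> and \<open>\<bar>x v - y v\<bar>\<close> are
  equal, because the coordinates on \<open>e\<close> add up to 1.
\<close>

definition segment_length :: "('a set \<Rightarrow> real) \<Rightarrow> 'a set \<Rightarrow> ('a \<Rightarrow> real) \<Rightarrow> ('a \<Rightarrow> real) \<Rightarrow> real" where
  "segment_length d e x y = d e * ((\<Sum>v\<in>e. \<bar>x v - y v\<bar>) / 2)"

text \<open>
  A path in the graph between two points is a concatenation of finitely many segments, the \<open>i\<close>-th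
  of them running inside the edge \<open>es ! i\<close> from \<open>xs ! i\<close> to \<open>xs ! Suc i\<close>. Its integral
  \<open>\<integral> w(s) ds\<close> is the sum of the lengths of the segments, each multiplied by the value of \<open>w\<close>
  on the edge in which it lies, namely \<open>d e powr - \<alpha>\<close>.
\<close>

definition point_path ::
  "'a graph \<Rightarrow> ('a \<Rightarrow> real) \<Rightarrow> ('a \<Rightarrow> real) list \<Rightarrow> 'a set list \<Rightarrow> ('a \<Rightarrow> real) \<Rightarrow> bool" where
  "point_path G x xs es y \<longleftrightarrow>
     set xs \<subseteq> graph_points G \<and> set es \<subseteq> edges G \<and> length xs = Suc (length es) \<and>
     hd xs = x \<and> last xs = y \<and>
     (\<forall>i<length es. xs ! i \<in> edge_points (es ! i) \<and> xs ! Suc i \<in> edge_points (es ! i))"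

definition path_integral ::
  "('a set \<Rightarrow> real) \<Rightarrow> real \<Rightarrow> ('a \<Rightarrow> real) list \<Rightarrow> 'a set list \<Rightarrow> real" where
  "path_integral d \<alpha> xs es =
     (\<Sum>i<length es. d (es ! i) powr - \<alpha> * segment_length d (es ! i) (xs ! i) (xs ! Suc i))"

text \<open>
  The value 0 away from the points of the graph is irrelevant; it only makes the function
  nonnegative and symmetric everywhere, as the locale \<^locale>\<open>Metric_space\<close> demands.
\<close>

definition graph_dist ::
  "'a graph \<Rightarrow> ('a set \<Rightarrow> real) \<Rightarrow> real \<Rightarrow> ('a \<Rightarrow> real) \<Rightarrow> ('a \<Rightarrow> real) \<Rightarrow> real" where
  "graph_dist G d \<alpha> x y =
     (if x \<in> graph_points G \<and> y \<in> graph_points G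
      then Inf {path_integral d \<alpha> xs es | xs es. point_path G x xs es y} else 0)"


section \<open>CAT(0) spaces\<close>

definition geodesic_curve ::
  "'p set \<Rightarrow> ('p \<Rightarrow> 'p \<Rightarrow> real) \<Rightarrow> 'p \<Rightarrow> (real \<Rightarrow> 'p) \<Rightarrow> 'p \<Rightarrow> bool" where
  "geodesic_curve S \<delta> x \<gamma> y \<longleftrightarrow>
     \<gamma> 0 = x \<and> \<gamma> (\<delta> x y) = y \<and> \<gamma> ` {0..\<delta> x y} \<subseteq> S \<and>
     (\<forall>s\<in>{0..\<delta> x y}. \<forall>t\<in>{0..\<delta> x y}. \<delta> (\<gamma> s) (\<gamma> t) = \<bar>s - t\<bar>)"

definition geodesic_space :: "'p set \<Rightarrow> ('p \<Rightarrow> 'p \<Rightarrow> real) \<Rightarrow> bool" where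
  "geodesic_space S \<delta> \<longleftrightarrow> Metric_space S \<delta> \<and>
     (\<forall>x\<in>S. \<forall>y\<in>S. \<exists>\<gamma>. geodesic_curve S \<delta> x \<gamma> y)"

definition CAT0 :: "'p set \<Rightarrow> ('p \<Rightarrow> 'p \<Rightarrow> real) \<Rightarrow> bool" where
  "CAT0 S \<delta> \<longleftrightarrow> geodesic_space S \<delta> \<and>
     (\<forall>a\<in>S. \<forall>b\<in>S. \<forall>c\<in>S. \<forall>\<gamma>\<^sub>a\<^sub>b \<gamma>\<^sub>b\<^sub>c \<gamma>\<^sub>c\<^sub>a.
        geodesic_curve S \<delta> a \<gamma>\<^sub>a\<^sub>b b \<and> geodesic_curve S \<delta> b \<gamma>\<^sub>b\<^sub>c c \<and> geodesic_curve S \<delta> c \<gamma>\<^sub>c\<^sub>a a \<longrightarrow>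
        (\<forall>(a' :: real^2) (b' :: real^2) (c' :: real^2).
           norm (a' - b') = \<delta> a b \<and> norm (b' - c') = \<delta> b c \<and> norm (c' - a') = \<delta> c a \<longrightarrow>
           (\<forall>x \<in> \<gamma>\<^sub>b\<^sub>c ` {0..\<delta> b c}. \<forall>x' \<in> closed_segment b' c'.
              \<delta> b x = norm (b' - x') \<longrightarrow> \<delta> x a \<le> norm (x' - a'))))"

end

theory Submission
  imports Defs
begin

text \<open>By an exchange argument, an edge outside a minimum spanning tree \<open>T\<close> is strictly heavier than
  every edge of the tree path between its endpoints. Raising the weights to a large power \<open>1 - \<alpha>\<close>
  therefore makes that whole tree path shorter than the edge, so edge geodesics stay in \<open>T\<close>. The
  threshold does not depend on \<open>T\<close>, so all minimum spanning trees coincide with one and the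
  same geodesic sub-graph, which gives uniqueness. A metric tree is obtained by attaching
  segments one at a time, which preserves the existence of geodesics and Gromov's four-point
  condition; and for geodesic spaces the four-point condition yields CAT(0) by two applications of
  the triangle inequality in the comparison triangle.\<close>

section \<open>Paths and chains\<close>

lemma path_edges_subset: "e \<in> set (path_edges p) \<Longrightarrow> e \<subseteq> set p"
  by (induction p rule: path_edges.induct) auto

lemma length_path_edges: "length (path_edges p) = length p - 1"
  by (induction p rule: path_edges.induct) auto

lemma graph_path_sing: "graph_path G u [x] v \<longleftrightarrow> x = u \<and> x = v \<and> x \<in> verts G"
  by (auto simp: graph_path_def)

lemma graph_path_Cons_Cons:
  "graph_path G u (x # y # p) v \<longleftrightarrow>
     x = u \<and> u \<in> verts G \<and> u \<notin> set (y # p) \<and> {u, y} \<in> edges G \<and> graph_path G y (y # p) v"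
  by (auto simp: graph_path_def)

lemma graph_path_mono:
  "graph_path G u p v \<Longrightarrow> verts G \<subseteq> verts H \<Longrightarrow> edges G \<subseteq> edges H \<Longrightarrow> graph_path H u p v"
  by (auto simp: graph_path_def)

text \<open>Cutting a path back to a later vertex drops only nonnegative weights. This is the step
  by which loops are erased in \<open>chain_imp_graph_path\<close>.\<close>

lemma graph_path_suffix:
  assumes "graph_path G y p z" "x \<in> set p" "\<forall>e\<in>edges G. 0 \<le> w e"
  shows "\<exists>q. graph_path G x q z \<and> path_weight w q \<le> path_weight w p"
  using assms
proof (induction p arbitrary: y rule: path_edges.induct)
  case (1 u v p)
  show ?case
  proof (cases "x = u")
    case True
    then have "graph_path G x (u # v # p) z" using 1 by (simp add: graph_path_Cons_Cons)
    then show ?thesis by blast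
  next
    case False
    then obtain q where "graph_path G x q z" "path_weight w q \<le> path_weight w (v # p)"
      using 1 by (auto simp: graph_path_Cons_Cons)
    moreover have "0 \<le> w {u, v}" using 1 by (auto simp: graph_path_Cons_Cons)
    ultimately show ?thesis by (intro exI[of _ q]) (auto simp: path_weight_def)
  qed
qed (auto simp: graph_path_sing path_weight_def graph_path_def)

text \<open>A walk with its total weight as an index. Vertices may repeat, so walks can be
  concatenated freely, unlike the paths of \<open>graph_path\<close>. The step relation
  \<open>R\<close> is a parameter because the same notion serves for walks along edges and for
  chains of segments between points.\<close>

inductive weighted_chain :: "('b \<Rightarrow> real \<Rightarrow> 'b \<Rightarrow> bool) \<Rightarrow> 'b \<Rightarrow> real \<Rightarrow> 'b \<Rightarrow> bool"
  for R where
  refl: "weighted_chain R x 0 x"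
| step: "R x c y \<Longrightarrow> weighted_chain R y i z \<Longrightarrow> weighted_chain R x (c + i) z"

lemma weighted_chain_single: "R x c y \<Longrightarrow> weighted_chain R x c y"
  using weighted_chain.step[OF _ weighted_chain.refl] by fastforce

lemma weighted_chain_trans:
  "weighted_chain R x i y \<Longrightarrow> weighted_chain R y j z \<Longrightarrow> weighted_chain R x (i + j) z"
  by (induction rule: weighted_chain.induct) (auto simp: add.assoc intro: weighted_chain.step)

definition weighted_edge :: "'a set set \<Rightarrow> ('a set \<Rightarrow> real) \<Rightarrow> 'a \<Rightarrow> real \<Rightarrow> 'a \<Rightarrow> bool" where
  "weighted_edge F w x c y \<longleftrightarrow> {x, y} \<in> F \<and> c = w {x, y}"

abbreviation adjacent :: "'a set set \<Rightarrow> 'a \<Rightarrow> 'a \<Rightarrow> bool" where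
  "adjacent F \<equiv> \<lambda>x y. {x, y} \<in> F"

lemma adjacent_sym: "(adjacent F)\<^sup>*\<^sup>* x y \<Longrightarrow> (adjacent F)\<^sup>*\<^sup>* y x"
  by (rule sympD[OF symp_rtranclp]) (auto intro: sympI simp: insert_commute)

lemma graph_path_imp_chain:
  "graph_path G u p v \<Longrightarrow> weighted_chain (weighted_edge (edges G) w) u (path_weight w p) v"
proof (induction p arbitrary: u rule: path_edges.induct)
  case (1 x y p)
  then have "weighted_chain (weighted_edge (edges G) w) y (path_weight w (y # p)) v"
    "weighted_edge (edges G) w u (w {x, y}) y"
    by (simp_all add: graph_path_Cons_Cons) (simp add: weighted_edge_def)
  from weighted_chain.step[OF this(2,1)] show ?case by (simp add: path_weight_def)
qed (auto simp: graph_path_sing path_weight_def graph_path_def intro: weighted_chain.refl)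

text \<open>Loop erasure: the walk is rebuilt from its end, and whenever the next vertex already
  lies on the path, the path is cut back to that vertex instead of being extended. Nonnegative
  weights ensure that this costs nothing.\<close>

lemma chain_imp_graph_path:
  assumes "weighted_chain (weighted_edge (edges G) w) u i v" "v \<in> verts G"
    "\<Union>(edges G) \<subseteq> verts G" "\<forall>e\<in>edges G. 0 \<le> w e"
  shows "\<exists>p. graph_path G u p v \<and> path_weight w p \<le> i"
  using assms
proof (induction rule: weighted_chain.induct)
  case (refl x)
  then show ?case by (intro exI[of _ "[x]"]) (auto simp: graph_path_sing path_weight_def)
next
  case (step x c y i z)
  then obtain p where p: "graph_path G y p z" "path_weight w p \<le> i" by blast
  have e: "{x, y} \<in> edges G" "c = w {x, y}" "0 \<le> c"
    using step by (auto simp: weighted_edge_def)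
  show ?case
  proof (cases "x \<in> set p")
    case True
    then obtain q where "graph_path G x q z" "path_weight w q \<le> path_weight w p"
      using graph_path_suffix[OF p(1)] step.prems(3) by blast
    then show ?thesis using p(2) e(3) by (intro exI[of _ q]) simp
  next
    case False
    obtain p' where p': "p = y # p'" using p(1) by (cases p) (auto simp: graph_path_def)
    have "graph_path G x (x # p) z" "path_weight w (x # p) \<le> c + i"
      using False p e step.prems unfolding p' by (auto simp: graph_path_Cons_Cons path_weight_def)
    then show ?thesis by blast
  qed
qed

lemma graph_path_imp_reach: "graph_path G u p v \<Longrightarrow> (adjacent (edges G))\<^sup>*\<^sup>* u v"
  by (induction p arbitrary: u rule: path_edges.induct)
    (auto simp: graph_path_sing graph_path_Cons_Cons graph_path_def[of _ _ "[]"]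
      intro: converse_rtranclp_into_rtranclp)

lemma reach_imp_graph_path:
  assumes "(adjacent (edges G))\<^sup>*\<^sup>* u v" "v \<in> verts G" "\<Union>(edges G) \<subseteq> verts G"
  shows "\<exists>p. graph_path G u p v"
proof -
  \<comment> \<open>Zero weights turn plain reachability into a chain, to which loop erasure
    applies.\<close>
  have "\<exists>i. weighted_chain (weighted_edge (edges G) (\<lambda>_. 0)) u i v"
    using assms(1)
  proof (induction rule: converse_rtranclp_induct)
    case base
    show ?case using weighted_chain.refl by fast
  next
    case (step x y)
    then obtain i where "weighted_chain (weighted_edge (edges G) (\<lambda>_. 0)) y i v" by blast
    moreover have "weighted_edge (edges G) (\<lambda>_. 0) x 0 y" using step(1) by (simp add: weighted_edge_def)
    ultimately show ?case by (blast intro: weighted_chain.step)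
  qed
  then show ?thesis using chain_imp_graph_path[OF _ assms(2,3), of "\<lambda>_. 0"] by auto
qed

section \<open>Minimum spanning trees\<close>

lemma finite_graph_edges_subset: "finite_graph G \<Longrightarrow> \<Union>(edges G) \<subseteq> verts G"
  by (auto simp: finite_graph_def)

lemma finite_graph_finite_edges: "finite_graph G \<Longrightarrow> finite (edges G)"
  by (rule finite_UnionD, rule finite_subset[OF finite_graph_edges_subset])
    (simp_all add: finite_graph_def)

lemma finite_graph_subgraph:
  "finite_graph G \<Longrightarrow> F \<subseteq> edges G \<Longrightarrow> finite_graph (verts G, F)"
  by (auto simp: finite_graph_def)

lemma connected_graph_iff_reach:
  assumes "finite_graph G"
  shows "connected_graph G \<longleftrightarrow>
    verts G \<noteq> {} \<and> (\<forall>u\<in>verts G. \<forall>v\<in>verts G. (adjacent (edges G))\<^sup>*\<^sup>* u v)"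
proof -
  have "(\<exists>p. graph_path G u p v) \<longleftrightarrow> (adjacent (edges G))\<^sup>*\<^sup>* u v" if "v \<in> verts G" for u v
    using graph_path_imp_reach[of G u _ v] reach_imp_graph_path[OF _ that finite_graph_edges_subset[OF assms]]
    by blast
  then show ?thesis by (simp add: connected_graph_def)
qed

text \<open>Each edge of a walk in \<open>F\<close> is replaced by a walk in \<open>F'\<close>. This
  covers both the deletion of an edge of a cycle and the exchange of two edges of a tree.\<close>

lemma connected_graph_exchange:
  assumes fin: "finite_graph (V, F)" "finite_graph (V, F')" and con: "connected_graph (V, F)"
    and reach: "\<And>a b. {a, b} \<in> F \<Longrightarrow> (adjacent F')\<^sup>*\<^sup>* a b"
  shows "connected_graph (V, F')"
proof -
  have "(adjacent F')\<^sup>*\<^sup>* u v" if "(adjacent F)\<^sup>*\<^sup>* u v" for u v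
    using that by (induction rule: rtranclp_induct) (auto dest: reach intro: rtranclp_trans)
  then show ?thesis
    using con unfolding connected_graph_iff_reach[OF fin(1)] connected_graph_iff_reach[OF fin(2)] by auto
qed

lemma graph_path_avoid:
  assumes "graph_path G u p v" "f \<notin> set (path_edges p)"
  shows "(adjacent (edges G - {f}))\<^sup>*\<^sup>* u v"
  using assms graph_path_imp_reach[of "(verts G, edges G - {f})" u p v] by (auto simp: graph_path_def)

text \<open>The rest of the cycle is a detour around its closing edge.\<close>

lemma cycle_edge_removable:
  assumes fin: "finite_graph G" and con: "connected_graph G" and cyc: "graph_cycle G p"
  shows "connected_graph (verts G, edges G - {{last p, hd p}})"
proof -
  obtain x y q where p: "p = x # y # q" "q \<noteq> []"
    using cyc by (cases p; cases "tl p") (auto simp: graph_cycle_def Suc_le_eq)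
  have path: "graph_path G (hd p) p (last p)" using cyc by (simp add: graph_cycle_def)
  then have "distinct p" by (simp add: graph_path_def)
  \<comment> \<open>The only edge of \<open>p\<close> at \<open>x\<close> is \<open>{x, y}\<close>,
    and \<open>last p\<close> differs from \<open>y\<close> because \<open>q\<close> is nonempty and
    \<open>p\<close> is distinct.\<close>
  then have "{last p, hd p} \<notin> set (path_edges p)"
    using path_edges_subset[of "{last p, hd p}" "y # q"] p by (auto simp: doubleton_eq_iff)
  from graph_path_avoid[OF path this] have *: "(adjacent (edges G - {{last p, hd p}}))\<^sup>*\<^sup>* (hd p) (last p)" .
  show ?thesis
  proof (rule connected_graph_exchange[of _ "edges G"])
    show "(adjacent (edges G - {{last p, hd p}}))\<^sup>*\<^sup>* a b" if "{a, b} \<in> edges G" for a b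
    proof (cases "{a, b} = {last p, hd p}")
      case True
      then show ?thesis using * adjacent_sym[OF *] by (auto simp: doubleton_eq_iff)
    next
      case False
      then show ?thesis using that by (intro r_into_rtranclp) auto
    qed
  qed (use fin con finite_graph_subgraph[OF fin, of "edges G - {{last p, hd p}}"] in auto)
qed

section \<open>Existence of spanning trees and of minimum spanning trees\<close>

lemma spanning_tree_exists:
  assumes fin: "finite_graph G" and con: "connected_graph G"
  shows "\<exists>T. spanning_tree G T"
proof -
  let ?A = "{F. F \<subseteq> edges G \<and> connected_graph (verts G, F)}"
  have "finite ?A" using finite_graph_finite_edges[OF fin] by (auto intro: finite_subset[of _ "Pow (edges G)"])
  moreover have "edges G \<in> ?A" using con by simp
  \<comment> \<open>An inclusion-minimal connected edge set on all vertices is a tree: a cycle would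
    have a removable edge.\<close>
  ultimately obtain F where F: "F \<in> ?A" "\<forall>F'\<in>?A. F' \<subseteq> F \<longrightarrow> F = F'"
    using finite_has_minimal[of ?A] by blast
  have finF: "finite_graph (verts G, F)" using F(1) fin by (simp add: finite_graph_subgraph)
  have "\<not> graph_cycle (verts G, F) p" for p
  proof
    assume p: "graph_cycle (verts G, F) p"
    have "F - {{last p, hd p}} \<in> ?A"
      using cycle_edge_removable[OF finF _ p] F(1) by auto
    then show False using F(2) p by (auto simp: graph_cycle_def)
  qed
  then have "spanning_tree G (verts G, F)"
    using F(1) finF by (auto simp: spanning_tree_def tree_graph_def)
  then show ?thesis by blast
qed

lemma minimum_spanning_tree_exists:
  assumes fin: "finite_graph G" and con: "connected_graph G"
  shows "\<exists>T. minimum_spanning_tree G d T"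
proof -
  let ?A = "{T. spanning_tree G T}"
  have "?A \<subseteq> {verts G} \<times> Pow (edges G)" by (auto simp: spanning_tree_def mem_Times_iff)
  then have fA: "finite ?A" using finite_graph_finite_edges[OF fin] by (rule_tac finite_subset) auto
  define T where "T = arg_min_on (\<lambda>T. sum d (edges T)) ?A"
  have ne: "?A \<noteq> {}" using spanning_tree_exists[OF assms] by blast
  have "T \<in> ?A" unfolding T_def by (rule arg_min_if_finite(1)[OF fA ne])
  moreover have "sum d (edges T) \<le> sum d (edges T')" if "T' \<in> ?A" for T'
    unfolding T_def by (rule arg_min_least[OF fA ne that])
  ultimately have "spanning_tree G T" "\<And>T'. spanning_tree G T' \<Longrightarrow> sum d (edges T) \<le> sum d (edges T')"
    by simp_all
  then show ?thesis unfolding minimum_spanning_tree_def by blast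
qed

section \<open>The exchange argument\<close>

lemma graph_path_split_edge:
  assumes "graph_path G u p v" "f \<in> set (path_edges p)"
  shows "\<exists>a b. f = {a, b} \<and> (adjacent (edges G - {f}))\<^sup>*\<^sup>* u a \<and> (adjacent (edges G - {f}))\<^sup>*\<^sup>* b v"
  using assms
proof (induction p arbitrary: u rule: path_edges.induct)
  case (1 x y p)
  have xy: "x = u" "u \<notin> set (y # p)" "{u, y} \<in> edges G" "graph_path G y (y # p) v"
    using "1.prems"(1) by (auto simp: graph_path_Cons_Cons)
  show ?case
  proof (cases "f = {u, y}")
    case True
    \<comment> \<open>The path visits \<open>u\<close> only once, so \<open>f\<close> does not occur
      again and the remainder survives its deletion.\<close>
    then have "f \<notin> set (path_edges (y # p))" using path_edges_subset[of f "y # p"] xy(2) by auto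
    from graph_path_avoid[OF xy(4) this] show ?thesis using True by blast
  next
    case False
    then have "f \<in> set (path_edges (y # p))" using "1.prems"(2) xy(1) by auto
    then obtain a b where ab: "f = {a, b}" "(adjacent (edges G - {f}))\<^sup>*\<^sup>* y a"
      "(adjacent (edges G - {f}))\<^sup>*\<^sup>* b v" using "1.IH"[OF xy(4)] by blast
    have "(adjacent (edges G - {f}))\<^sup>*\<^sup>* u a"
      using False xy(3) ab(2) by (intro converse_rtranclp_into_rtranclp[of _ u y]) auto
    with ab show ?thesis by blast
  qed
qed auto

text \<open>Exchanging \<open>f\<close> for \<open>{u, v}\<close> keeps the graph connected, so by
  minimality of \<open>T\<close> it cannot lower the total weight. This gives
  \<open>d f \<le> d {u, v}\<close>, and distinctness of the weights makes it strict.\<close>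

lemma minimum_spanning_tree_path_less:
  assumes fin: "finite_graph G" and pos: "\<forall>e\<in>edges G. 0 < d e" and inj: "inj_on d (edges G)"
    and mst: "minimum_spanning_tree G d T" and e: "{u, v} \<in> edges G - edges T"
    and p: "graph_path T u p v" and f: "f \<in> set (path_edges p)"
  shows "d f < d {u, v}"
proof -
  define F where "F = insert {u, v} (edges T - {f})"
  have T: "verts T = verts G" "edges T \<subseteq> edges G" "connected_graph T" "finite_graph T"
    using mst by (auto simp: minimum_spanning_tree_def spanning_tree_def tree_graph_def)
  have fT: "f \<in> edges T" using p f by (auto simp: graph_path_def)
  have FG: "F \<subseteq> edges G" using T e by (auto simp: F_def)
  obtain a b where ab: "f = {a, b}" "(adjacent (edges T - {f}))\<^sup>*\<^sup>* u a" "(adjacent (edges T - {f}))\<^sup>*\<^sup>* b v"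
    using graph_path_split_edge[OF p f] by blast
  have mono: "(adjacent F)\<^sup>*\<^sup>* x y" if "(adjacent (edges T - {f}))\<^sup>*\<^sup>* x y" for x y
    using that by (rule rtranclp_mono[THEN predicate2D, rotated]) (auto simp: F_def)
  have "(adjacent F)\<^sup>*\<^sup>* u v" by (rule r_into_rtranclp) (simp add: F_def)
  \<comment> \<open>The detour around \<open>f\<close> runs from \<open>a\<close> back to
    \<open>u\<close>, across the new edge, and from \<open>v\<close> back to
    \<open>b\<close>.\<close>
  then have fF: "(adjacent F)\<^sup>*\<^sup>* a b"
    using adjacent_sym[OF mono[OF ab(2)]] adjacent_sym[OF mono[OF ab(3)]] by (meson rtranclp_trans)
  \<comment> \<open>\<open>F\<close> is in fact a tree, but as weights are positive it suffices that it contains one.\<close>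
  have con: "connected_graph (verts G, F)"
  proof (rule connected_graph_exchange[of _ "edges T"])
    show "(adjacent F)\<^sup>*\<^sup>* x y" if "{x, y} \<in> edges T" for x y
    proof (cases "{x, y} = f")
      case True
      then show ?thesis using fF adjacent_sym[OF fF] ab(1) by (auto simp: doubleton_eq_iff)
    next
      case False
      then show ?thesis using that by (intro r_into_rtranclp) (auto simp: F_def)
    qed
  qed (use T finite_graph_subgraph[OF fin FG] finite_graph_subgraph[OF T(4)] in \<open>auto simp flip: T(1)\<close>)
  obtain T' where T': "spanning_tree (verts G, F) T'"
    using spanning_tree_exists[OF finite_graph_subgraph[OF fin FG] con] by blast
  then have "spanning_tree G T'" "edges T' \<subseteq> F" using FG by (auto simp: spanning_tree_def)
  have finF: "finite F" using finite_graph_finite_edges[OF fin] FG finite_subset by blast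
  have "sum d (edges T) \<le> sum d (edges T')"
    using mst \<open>spanning_tree G T'\<close> unfolding minimum_spanning_tree_def by blast
  also have "\<dots> \<le> sum d F"
    using finF \<open>edges T' \<subseteq> F\<close> pos FG by (intro sum_mono2) (auto intro!: less_imp_le)
  also have "\<dots> = d {u, v} + (sum d (edges T) - d f)"
    unfolding F_def using fT e finite_graph_finite_edges[OF T(4)]
    by (subst sum.insert) (auto simp: sum_diff1)
  finally have "d f \<le> d {u, v}" by simp
  moreover have "d f \<noteq> d {u, v}" using inj e fT T(2) by (metis DiffE inj_onD subsetD)
  ultimately show ?thesis by simp
qed

section \<open>The geodesic sub-graph\<close>

text \<open>A path has fewer edges than the graph has vertices, and each of its edges weighs at most
  \<open>c\<close> divided by the number of vertices. Hence the domination factor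
  \<open>card (verts G)\<close> is large enough for every path.\<close>

lemma path_weight_less:
  fixes w :: "'a set \<Rightarrow> real" and c :: real
  assumes fin: "finite (verts G)" and p: "graph_path G u p v" and c: "0 < c"
    and w: "\<And>f. f \<in> set (path_edges p) \<Longrightarrow> card (verts G) * w f \<le> c"
  shows "path_weight w p < c"
proof -
  let ?n = "card (verts G)"
  have "length p \<le> ?n" "p \<noteq> []"
    using p fin by (auto simp: graph_path_def simp flip: distinct_card intro: card_mono)
  then have n: "0 < ?n" "length (path_edges p) < ?n" by (cases p; auto simp: length_path_edges)+
  have "path_weight w p \<le> (\<Sum>_\<leftarrow>path_edges p. c / ?n)"
    unfolding path_weight_def
    by (intro sum_list_mono) (use w n in \<open>simp add: field_simps\<close>)
  also have "\<dots> = length (path_edges p) * (c / ?n)" by (simp add: sum_list_triv)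
  also have "\<dots> < ?n * (c / ?n)" using n c by (intro mult_strict_right_mono) auto
  finally show ?thesis using n by simp
qed

text \<open>Replacing an edge outside \<open>T\<close> by the tree path between its endpoints
  shortens a path strictly, so geodesics use tree edges only. Conversely every tree edge is a
  geodesic, since a tree has no second path between its endpoints.\<close>

lemma geodesic_subgraph_eq_tree:
  assumes fin: "finite_graph G" and T: "spanning_tree G T" and pos: "\<forall>e\<in>edges G. 0 < w e"
    and short: "\<And>u v p. {u, v} \<in> edges G - edges T \<Longrightarrow> graph_path T u p v \<Longrightarrow> path_weight w p < w {u, v}"
  shows "geodesic_subgraph G w = T"
proof -
  have TG: "verts T = verts G" "edges T \<subseteq> edges G" "connected_graph T" "finite_graph T"
    "\<nexists>p. graph_cycle T p"
    using T by (auto simp: spanning_tree_def tree_graph_def)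
  have better: "\<exists>q. graph_path T u q v \<and> path_weight w q \<le> path_weight w p \<and>
      (\<not> set (path_edges p) \<subseteq> edges T \<longrightarrow> path_weight w q < path_weight w p)"
    if "graph_path G u p v" for u p v
  proof -
    \<comment> \<open>The substituted tree paths may overlap, so their concatenation is first only a
      chain; loop erasure then makes it a path without increasing its weight.\<close>
    have "\<exists>i. weighted_chain (weighted_edge (edges T) w) u i v \<and> i \<le> path_weight w p \<and>
      (\<not> set (path_edges p) \<subseteq> edges T \<longrightarrow> i < path_weight w p)"
      using that
    proof (induction p arbitrary: u rule: path_edges.induct)
      case (1 x y p)
      then obtain i where i: "weighted_chain (weighted_edge (edges T) w) y i v" "i \<le> path_weight w (y # p)"
        "\<not> set (path_edges (y # p)) \<subseteq> edges T \<longrightarrow> i < path_weight w (y # p)"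
        by (auto simp: graph_path_Cons_Cons)
      have xy: "{x, y} \<in> edges G" "x \<in> verts T" "y \<in> verts T" "u = x"
        using 1 TG by (auto simp: graph_path_def)
      have "\<exists>j. weighted_chain (weighted_edge (edges T) w) x j y \<and> j \<le> w {x, y} \<and>
          ({x, y} \<notin> edges T \<longrightarrow> j < w {x, y})"
      proof (cases "{x, y} \<in> edges T")
        case True
        then show ?thesis
          by (intro exI[of _ "w {x, y}"]) (auto intro: weighted_chain_single simp: weighted_edge_def)
      next
        case False
        obtain q where "graph_path T x q y" using TG(3) xy by (auto simp: connected_graph_def)
        then show ?thesis using short[of x y q] False xy(1) graph_path_imp_chain[of T x q y w]
          by (intro exI[of _ "path_weight w q"]) auto
      qed
      then obtain j where j: "weighted_chain (weighted_edge (edges T) w) x j y" "j \<le> w {x, y}"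
          "{x, y} \<notin> edges T \<longrightarrow> j < w {x, y}" by blast
      show ?case
        using weighted_chain_trans[OF j(1) i(1)] i(2,3) j(2,3) xy(4)
        by (intro exI[of _ "j + i"]) (auto simp: path_weight_def)
    qed (auto simp: graph_path_sing path_weight_def graph_path_def intro: weighted_chain.refl)
    moreover have "v \<in> verts T" using that TG(1) by (auto simp: graph_path_def)
    ultimately show ?thesis
      using chain_imp_graph_path[of T w u _ v] finite_graph_edges_subset[OF TG(4)] TG(2) pos
      by (meson less_imp_le order.trans subsetD order.strict_trans1)
  qed
  have geo_T: "set (path_edges p) \<subseteq> edges T" if "edge_geodesic G w u p v" for u p v
  proof (rule ccontr)
    assume "\<not> set (path_edges p) \<subseteq> edges T"
    moreover have "graph_path G u p v" using that by (simp add: edge_geodesic_def)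
    ultimately obtain q where "graph_path T u q v" "path_weight w q < path_weight w p"
      using better[of u p v] by metis
    then show False
      using that graph_path_mono[of T u q v G] TG by (force simp: edge_geodesic_def)
  qed
  \<comment> \<open>One-vertex geodesics put every vertex into the geodesic sub-graph, including the
    vertex of a graph without edges.\<close>
  have vert: "edge_geodesic G w v [v] v" if "v \<in> verts G" for v
  proof -
    have "0 \<le> path_weight w q" if "graph_path G v q v" for q
      unfolding path_weight_def
      by (intro sum_list_nonneg) (use pos that in \<open>auto simp: graph_path_def intro!: less_imp_le\<close>)
    then show ?thesis using that by (auto simp: edge_geodesic_def graph_path_sing) (simp add: path_weight_def)
  qed
  have edge: "edge_geodesic G w u [u, v] v" if "{u, v} \<in> edges T" "u \<noteq> v" for u v
  proof -
    have uv: "u \<in> verts G" "v \<in> verts G" using that finite_graph_edges_subset[OF TG(4)] TG(1) by auto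
    have "path_weight w [u, v] \<le> path_weight w p" if p: "graph_path G u p v" for p
    proof -
      obtain q where q: "graph_path T u q v" "path_weight w q \<le> path_weight w p" using better[OF p] by blast
      have "\<not> graph_cycle T q" using TG by blast
      \<comment> \<open>With three or more vertices, \<open>q\<close> together with the edge
        \<open>{u, v}\<close> would be a cycle in \<open>T\<close>.\<close>
      then have "length q < 3"
        using q(1) \<open>{u, v} \<in> edges T\<close> by (auto simp: graph_cycle_def graph_path_def insert_commute)
      then have "q = [u, v]" using q(1) \<open>u \<noteq> v\<close>
        by (cases q; cases "tl q"; cases "tl (tl q)") (auto simp: graph_path_def)
      then show ?thesis using q(2) by simp
    qed
    then show ?thesis using that uv TG(2) by (auto simp: edge_geodesic_def graph_path_Cons_Cons graph_path_sing)
  qed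
  have "fst (geodesic_subgraph G w) = verts T"
  proof
    show "fst (geodesic_subgraph G w) \<subseteq> verts T"
      unfolding geodesic_subgraph_def TG(1) by (auto simp: edge_geodesic_def graph_path_def)
    show "verts T \<subseteq> fst (geodesic_subgraph G w)"
      unfolding geodesic_subgraph_def TG(1) using vert by fastforce
  qed
  moreover have "snd (geodesic_subgraph G w) = edges T"
  proof
    show "snd (geodesic_subgraph G w) \<subseteq> edges T"
      unfolding geodesic_subgraph_def using geo_T by auto
    show "edges T \<subseteq> snd (geodesic_subgraph G w)"
    proof
      fix e assume e: "e \<in> edges T"
      then obtain u v where uv: "e = {u, v}" "u \<noteq> v" "u \<in> verts G" "v \<in> verts G"
        using TG(4) unfolding finite_graph_def TG(1) by blast
      then have "edge_geodesic G w u [u, v] v" "e \<in> set (path_edges [u, v])" using edge e by auto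
      then show "e \<in> snd (geodesic_subgraph G w)" unfolding geodesic_subgraph_def using uv by (simp only: snd_conv) blast
    qed
  qed
  ultimately show ?thesis by (simp add: prod_eq_iff)
qed

text \<open>The quotient \<open>(a / b) powr s\<close> tends to 0 because \<open>a / b < 1\<close>,
  so it eventually beats any constant factor. In the application \<open>c\<close> is the number of
  vertices and \<open>s\<close> is \<open>1 - \<alpha>\<close>.\<close>

lemma eventually_powr_dominates:
  fixes a b c :: real
  assumes "0 < a" "a < b"
  shows "\<forall>\<^sub>F s in at_top. c * a powr s \<le> b powr s"
proof -
  have "filterlim (\<lambda>s. ln (a / b) * s) at_bot at_top"
    using assms by (intro filterlim_tendsto_neg_mult_at_bot[OF tendsto_const _ filterlim_ident]) auto
  then have "((\<lambda>s. (a / b) powr s) \<longlongrightarrow> 0) at_top"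
    using assms by (simp add: powr_def mult.commute filterlim_compose[OF exp_at_bot])
  then have "((\<lambda>s. c * (a / b) powr s) \<longlongrightarrow> 0) at_top" by (rule tendsto_mult_right_zero)
  then have "\<forall>\<^sub>F s in at_top. c * (a / b) powr s < 1" by (rule order_tendstoD) simp
  then show ?thesis
    by eventually_elim (use assms in \<open>simp add: powr_divide field_simps\<close>)
qed

text \<open>The threshold is quantified before the tree, which is what later yields uniqueness: it
  depends only on comparisons between pairs of edges of \<open>G\<close>.\<close>

lemma geodesic_subgraph_eq_mst:
  assumes fin: "finite_graph G" and pos: "\<forall>e\<in>edges G. 0 < d e" and inj: "inj_on d (edges G)"
  shows "\<exists>\<alpha>s::real. \<forall>\<alpha>\<le>\<alpha>s. \<forall>T. minimum_spanning_tree G d T \<longrightarrow>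
    geodesic_subgraph G (\<lambda>e. d e powr (1 - \<alpha>)) = T"
proof -
  let ?n = "real (card (verts G))"
  \<comment> \<open>There are finitely many pairs of edges, so one bound \<open>s0\<close> works for
    all of them; it becomes the threshold \<open>1 - s0\<close> for \<alpha>.\<close>
  have "\<forall>\<^sub>F s in at_top. \<forall>f\<in>edges G. \<forall>e\<in>edges G. d f < d e \<longrightarrow> ?n * d f powr s \<le> d e powr s"
    using pos by (intro eventually_ball_finite finite_graph_finite_edges[OF fin] ballI)
      (auto intro: eventually_powr_dominates)
  then obtain s0 where s0: "\<And>s f e. \<lbrakk>s \<ge> s0; f \<in> edges G; e \<in> edges G; d f < d e\<rbrakk> \<Longrightarrow>
      ?n * d f powr s \<le> d e powr s"
    unfolding eventually_at_top_linorder by blast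
  have "geodesic_subgraph G (\<lambda>e. d e powr (1 - \<alpha>)) = T"
    if \<alpha>: "\<alpha> \<le> 1 - s0" and mst: "minimum_spanning_tree G d T" for \<alpha> T
  proof (rule geodesic_subgraph_eq_tree[OF fin])
    show ST: "spanning_tree G T" using mst by (simp add: minimum_spanning_tree_def)
    show "\<forall>e\<in>edges G. 0 < d e powr (1 - \<alpha>)" using pos by auto
    fix u v p assume e: "{u, v} \<in> edges G - edges T" and p: "graph_path T u p v"
    have T: "verts T = verts G" "edges T \<subseteq> edges G" using ST by (auto simp: spanning_tree_def)
    show "path_weight (\<lambda>e. d e powr (1 - \<alpha>)) p < d {u, v} powr (1 - \<alpha>)"
    proof (rule path_weight_less[OF _ p])
      show "finite (verts T)" using fin T by (simp add: finite_graph_def)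
      show "0 < d {u, v} powr (1 - \<alpha>)" using pos e by auto
      fix f assume f: "f \<in> set (path_edges p)"
      then have "f \<in> edges G" using p T by (auto simp: graph_path_def)
      then show "card (verts T) * d f powr (1 - \<alpha>) \<le> d {u, v} powr (1 - \<alpha>)"
        using s0[of "1 - \<alpha>" f "{u, v}"] minimum_spanning_tree_path_less[OF fin pos inj mst e p f] \<alpha> e T
        by simp
    qed
  qed
  then show ?thesis by blast
qed

section \<open>The four-point condition and CAT(0)\<close>

text \<open>Gromov's condition of 0-hyperbolicity: in a metric space, of the three sums of distances
  over opposite pairs, the two largest agree.\<close>

definition four_point :: "'p set \<Rightarrow> ('p \<Rightarrow> 'p \<Rightarrow> real) \<Rightarrow> bool" where
  "four_point S \<delta> \<longleftrightarrow> (\<forall>a\<in>S. \<forall>b\<in>S. \<forall>c\<in>S. \<forall>x\<in>S.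
     \<delta> a x + \<delta> b c \<le> max (\<delta> a b + \<delta> c x) (\<delta> a c + \<delta> b x))"

lemma geodesic_curve_dist:
  assumes "geodesic_curve S \<delta> x \<gamma> y" "0 \<le> \<delta> x y" "s \<in> {0..\<delta> x y}"
  shows "\<delta> x (\<gamma> s) = s" "\<delta> (\<gamma> s) y = \<delta> x y - s" "\<gamma> s \<in> S"
proof -
  have "\<delta> (\<gamma> 0) (\<gamma> s) = \<bar>0 - s\<bar>" "\<delta> (\<gamma> s) (\<gamma> (\<delta> x y)) = \<bar>s - \<delta> x y\<bar>"
    using assms unfolding geodesic_curve_def by (metis atLeastAtMost_iff order.refl)+
  then show "\<delta> x (\<gamma> s) = s" "\<delta> (\<gamma> s) y = \<delta> x y - s"
    using assms by (auto simp: geodesic_curve_def)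
  show "\<gamma> s \<in> S" using assms by (auto simp: geodesic_curve_def)
qed

text \<open>The four-point condition bounds the distance from \<open>a\<close> to \<open>x\<close> by one of the differences
  \<open>\<delta> a b - \<delta> b x\<close> and \<open>\<delta> a c - \<delta> c x\<close>; in the comparison triangle the same differences bound the
  corresponding distance from below.\<close>

lemma CAT0_if_four_point:
  assumes geo: "geodesic_space S \<delta>" and four: "four_point S \<delta>"
  shows "CAT0 S \<delta>"
  unfolding CAT0_def
proof (intro conjI ballI allI impI geo)
  interpret Metric_space S \<delta> using geo by (simp add: geodesic_space_def)
  fix a b c and \<gamma>ab \<gamma>bc \<gamma>ca and a' b' c' :: "real^2" and x x'
  assume S: "a \<in> S" "b \<in> S" "c \<in> S"
    and g: "geodesic_curve S \<delta> a \<gamma>ab b \<and> geodesic_curve S \<delta> b \<gamma>bc c \<and> geodesic_curve S \<delta> c \<gamma>ca a"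
    and n: "norm (a' - b') = \<delta> a b \<and> norm (b' - c') = \<delta> b c \<and> norm (c' - a') = \<delta> c a"
    and x: "x \<in> \<gamma>bc ` {0..\<delta> b c}" "x' \<in> closed_segment b' c'" "\<delta> b x = norm (b' - x')"
  obtain s where s: "s \<in> {0..\<delta> b c}" "x = \<gamma>bc s" using x by blast
  note dist = geodesic_curve_dist[OF conjunct1[OF conjunct2[OF g]] nonneg s(1), folded s(2)]
  have "\<delta> a x + \<delta> b c \<le> max (\<delta> a b + \<delta> c x) (\<delta> a c + \<delta> b x)"
    using four S dist(3) unfolding four_point_def by blast
  \<comment> \<open>As \<open>x'\<close> lies on the comparison side, its distance to
    \<open>c'\<close> is forced to be \<open>\<delta> c x\<close>. The triangle inequality at
    \<open>x'\<close> then bounds both differences.\<close>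
  moreover have "norm (b' - x') + norm (x' - c') = norm (b' - c')"
    using x(2) by (metis between between_mem_segment dist_norm)
  moreover have "norm (a' - b') \<le> norm (x' - a') + norm (b' - x')"
    "norm (c' - a') \<le> norm (x' - a') + norm (x' - c')"
    by norm+
  ultimately show "\<delta> x a \<le> norm (x' - a')"
    using dist n x(3) commute[of x a] commute[of c x] commute[of c a] by (auto simp: max_def split: if_splits)
qed

section \<open>Attaching a segment at a point\<close>

lemma geodesic_curve_reverse:
  assumes "Metric_space S \<delta>" "geodesic_curve S \<delta> x \<gamma> y"
  shows "geodesic_curve S \<delta> y (\<lambda>s. \<gamma> (\<delta> x y - s)) x"
proof -
  interpret Metric_space S \<delta> by fact
  show ?thesis using assms(2) commute[of y x] unfolding geodesic_curve_def by (auto simp: image_subset_iff)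
qed

text \<open>The linear arithmetic of the attachment. \<open>A\<close>, \<open>B\<close>,
  \<open>C\<close>, \<open>X\<close> are the distances of the four projections to the attaching
  point and \<open>ha\<close>, \<open>hb\<close>, \<open>hc\<close>, \<open>hx\<close> the heights;
  a point of nonzero height projects to the attaching point, so its distance there is 0.\<close>

lemma four_point_heights:
  fixes A B C X ab ac ax bc bx cx ha hb hc hx :: real
  assumes "ax + bc \<le> ab + cx \<or> ax + bc \<le> ac + bx"
    and "\<bar>A - B\<bar> \<le> ab" "\<bar>A - C\<bar> \<le> ac" "\<bar>A - X\<bar> \<le> ax" "\<bar>B - C\<bar> \<le> bc" "\<bar>B - X\<bar> \<le> bx" "\<bar>C - X\<bar> \<le> cx"
    and "ab \<le> A + B" "ac \<le> A + C" "ax \<le> A + X" "bc \<le> B + C" "bx \<le> B + X" "cx \<le> C + X"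
    and "ha = 0 \<or> A = 0 \<and> 0 \<le> ha" "hb = 0 \<or> B = 0 \<and> 0 \<le> hb"
        "hc = 0 \<or> C = 0 \<and> 0 \<le> hc" "hx = 0 \<or> X = 0 \<and> 0 \<le> hx"
  shows "ax + \<bar>ha - hx\<bar> + (bc + \<bar>hb - hc\<bar>) \<le> ab + \<bar>ha - hb\<bar> + (cx + \<bar>hc - hx\<bar>) \<or>
         ax + \<bar>ha - hx\<bar> + (bc + \<bar>hb - hc\<bar>) \<le> ac + \<bar>ha - hc\<bar> + (bx + \<bar>hb - hx\<bar>)"
  using assms by (smt (verit))

text \<open>A segment of length \<open>L\<close> is attached to \<open>S\<close> at the point \<open>p\<close>. The map \<open>\<pi>\<close> collapses it to \<open>p\<close>,
  and \<open>h\<close> is the height on it; the distance of the enlarged space is the sum of the distances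
  of the projections and of the heights.\<close>

locale attached_segment = Metric_space S \<delta>
  for S :: "'p set" and \<delta> +
  fixes S' p \<pi> h \<sigma> and L :: real
  assumes geodesic: "\<And>x y. x \<in> S \<Longrightarrow> y \<in> S \<Longrightarrow> \<exists>\<gamma>. geodesic_curve S \<delta> x \<gamma> y"
    and four: "four_point S \<delta>"
    and p: "p \<in> S" and sub: "S \<subseteq> S'"
    and old: "\<And>x. x \<in> S \<Longrightarrow> \<pi> x = x \<and> h x = 0"
    and new: "\<And>x. x \<in> S' - S \<Longrightarrow> \<pi> x = p \<and> h x \<in> {0..L}"
    and \<sigma>: "\<And>t. t \<in> {0..L} \<Longrightarrow> \<sigma> t \<in> S' \<and> \<pi> (\<sigma> t) = p \<and> h (\<sigma> t) = t"
    and inj: "\<And>x y. x \<in> S' \<Longrightarrow> y \<in> S' \<Longrightarrow> \<pi> x = \<pi> y \<Longrightarrow> h x = h y \<Longrightarrow> x = y"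
begin

definition \<delta>' :: "'p \<Rightarrow> 'p \<Rightarrow> real" where
  "\<delta>' x y = \<delta> (\<pi> x) (\<pi> y) + \<bar>h x - h y\<bar>"

lemma point_cases:
  assumes "x \<in> S'"
  obtains "x \<in> S" "\<pi> x = x" "h x = 0" | "\<pi> x = p" "h x \<in> {0..L}"
  using assms new old by blast

lemma pi_in: "x \<in> S' \<Longrightarrow> \<pi> x \<in> S"
  using p by (elim point_cases) auto

lemma Metric_space': "Metric_space S' \<delta>'"
proof
  fix x y z
  show "0 \<le> \<delta>' x y" "\<delta>' x y = \<delta>' y x" by (auto simp: \<delta>'_def commute)
  assume xy: "x \<in> S'" "y \<in> S'"
  show "\<delta>' x y = 0 \<longleftrightarrow> x = y"
  proof
    assume "\<delta>' x y = 0"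
    then have "\<delta> (\<pi> x) (\<pi> y) = 0" "h x = h y"
      using nonneg[of "\<pi> x" "\<pi> y"] unfolding \<delta>'_def by linarith+
    then show "x = y" using inj xy pi_in by simp
  qed (use xy pi_in in \<open>simp add: \<delta>'_def\<close>)
  assume "z \<in> S'"
  then show "\<delta>' x z \<le> \<delta>' x y + \<delta>' y z"
    using triangle[of "\<pi> x" "\<pi> y" "\<pi> z"] xy pi_in by (simp add: \<delta>'_def)
qed

text \<open>The projections satisfy the condition of the old space, and heights occur only above
  \<open>p\<close>. The triangle inequalities through \<open>p\<close> supply the rest of the input
  for \<open>four_point_heights\<close>.\<close>

lemma four_point': "four_point S' \<delta>'"
  unfolding four_point_def
proof (intro ballI)
  fix a b c x assume S: "a \<in> S'" "b \<in> S'" "c \<in> S'" "x \<in> S'"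
  note in_S = S[THEN pi_in]
  let ?d = "\<lambda>x y. \<delta> (\<pi> x) (\<pi> y)"
  have height: "h z = 0 \<or> \<delta> (\<pi> z) p = 0 \<and> 0 \<le> h z" if "z \<in> S'" for z
    using p by (cases rule: point_cases[OF that]) auto
  have via_p: "\<bar>\<delta> u p - \<delta> v p\<bar> \<le> \<delta> u v" "\<delta> u v \<le> \<delta> u p + \<delta> v p" if "u \<in> S" "v \<in> S" for u v
    using triangle[OF that(1) p that(2)] triangle[OF that(1,2) p] triangle[OF that(2,1) p]
    by (simp_all add: commute[of p] commute[of v u])
  have "?d a x + ?d b c \<le> ?d a b + ?d c x \<or> ?d a x + ?d b c \<le> ?d a c + ?d b x"
    using four in_S unfolding four_point_def by (simp add: le_max_iff_disj)
  then have "\<delta>' a x + \<delta>' b c \<le> \<delta>' a b + \<delta>' c x \<or> \<delta>' a x + \<delta>' b c \<le> \<delta>' a c + \<delta>' b x"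
    unfolding \<delta>'_def 
    by (rule four_point_heights[where A = "\<delta> (\<pi> a) p" and B = "\<delta> (\<pi> b) p" and C = "\<delta> (\<pi> c) p"
          and X = "\<delta> (\<pi> x) p"]) (intro via_p in_S height S)+
  then show "\<delta>' a x + \<delta>' b c \<le> max (\<delta>' a b + \<delta>' c x) (\<delta>' a c + \<delta>' b x)"
    by (simp add: le_max_iff_disj)
qed

text \<open>The geodesic follows an old one to \<open>p\<close> and then climbs the segment.\<close>

lemma geodesic_attach:
  assumes x: "x \<in> S" and y: "\<pi> y = p" "h y \<in> {0..L}" "y \<in> S'"
  shows "\<exists>\<gamma>. geodesic_curve S' \<delta>' x \<gamma> y"
proof -
  obtain \<gamma> where \<gamma>: "geodesic_curve S \<delta> x \<gamma> p" using geodesic x p by blast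
  define D where "D = \<delta> x p"
  have D: "0 \<le> D" by (simp add: D_def)
  have len: "\<delta>' x y = D + h y" using x y old by (simp add: \<delta>'_def D_def)
  have \<gamma>S: "\<gamma> s \<in> S" "\<delta> (\<gamma> s) p = D - s" if "s \<in> {0..D}" for s
    using geodesic_curve_dist[OF \<gamma>] that by (simp_all add: D_def)
  have \<gamma>d: "\<delta> (\<gamma> s) (\<gamma> t) = \<bar>s - t\<bar>" if "s \<in> {0..D}" "t \<in> {0..D}" for s t
    using \<gamma> that by (auto simp: geodesic_curve_def D_def)
  \<comment> \<open>\<open>D\<close> is the time of arrival at \<open>p\<close>; from then on the
    height equals the elapsed time \<open>s - D\<close>.\<close>
  define \<gamma>' where "\<gamma>' s = (if s \<le> D then \<gamma> s else \<sigma> (s - D))" for s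
  have lo: "\<gamma>' s \<in> S'" "\<pi> (\<gamma>' s) = \<gamma> s" "h (\<gamma>' s) = 0" if "s \<in> {0..D}" for s
    using \<gamma>S[OF that] that old sub by (auto simp: \<gamma>'_def)
  have hi: "\<gamma>' s \<in> S'" "\<pi> (\<gamma>' s) = p" "h (\<gamma>' s) = s - D" if "s \<in> {D<..D + h y}" for s
    using \<sigma>[of "s - D"] that y(2) by (auto simp: \<gamma>'_def)
  have "\<gamma> D = p" "\<gamma> 0 = x" using \<gamma> by (auto simp: geodesic_curve_def D_def)
  have "geodesic_curve S' \<delta>' x \<gamma>' y"
    unfolding geodesic_curve_def len
  proof (intro conjI ballI)
    show "\<gamma>' 0 = x" using \<open>\<gamma> 0 = x\<close> D by (simp add: \<gamma>'_def)
    show "\<gamma>' (D + h y) = y"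
    \<comment> \<open>At height 0 the end point is \<open>p\<close> itself, and \<gamma> already
      ends there.\<close>
    proof (cases "h y = 0")
      case True
      then have "\<gamma>' (D + h y) = p" using \<open>\<gamma> D = p\<close> by (simp add: \<gamma>'_def)
      then show ?thesis using inj[of p y] p sub y old[of p] True by auto
    next
      case False
      then show ?thesis using y hi[of "D + h y"] inj[of "\<gamma>' (D + h y)" y] by auto
    qed
    show "\<gamma>' ` {0..D + h y} \<subseteq> S'"
      using lo hi by (auto simp: image_subset_iff) (meson atLeastAtMost_iff greaterThanAtMost_iff not_le)
    fix s t assume st: "s \<in> {0..D + h y}" "t \<in> {0..D + h y}"
    show "\<delta>' (\<gamma>' s) (\<gamma>' t) = \<bar>s - t\<bar>"
      using st p \<gamma>S \<gamma>d commute[of p "\<gamma> t"]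
      by (cases "s \<le> D"; cases "t \<le> D") (simp_all add: \<delta>'_def lo hi)
  qed
  then show ?thesis by blast
qed

text \<open>The map \<sigma> is parametrised by height, hence by arc length, and moves upwards; the
  other order of \<open>x\<close> and \<open>y\<close> is obtained by reversal.\<close>

lemma geodesic_segment:
  assumes x: "\<pi> x = p" "h x \<in> {0..L}" "x \<in> S'" and y: "\<pi> y = p" "h y \<in> {0..L}" "y \<in> S'"
    and le: "h x \<le> h y"
  shows "\<exists>\<gamma>. geodesic_curve S' \<delta>' x \<gamma> y"
proof -
  have len: "\<delta>' x y = h y - h x" using x y le p by (simp add: \<delta>'_def)
  have s: "\<sigma> (h x + t) \<in> S'" "\<pi> (\<sigma> (h x + t)) = p" "h (\<sigma> (h x + t)) = h x + t"
    if "t \<in> {0..h y - h x}" for t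
    using \<sigma>[of "h x + t"] that x y by auto
  have "geodesic_curve S' \<delta>' x (\<lambda>s. \<sigma> (h x + s)) y"
    unfolding geodesic_curve_def len
  proof (intro conjI ballI)
    show "\<sigma> (h x + 0) = x" "\<sigma> (h x + (h y - h x)) = y"
      using x y \<sigma>[of "h x"] \<sigma>[of "h y"] inj[of "\<sigma> (h x)" x] inj[of "\<sigma> (h y)" y] by simp_all
  qed (use s p in \<open>auto simp: \<delta>'_def image_subset_iff\<close>)
  then show ?thesis by blast
qed

lemma geodesic': "x \<in> S' \<Longrightarrow> y \<in> S' \<Longrightarrow> \<exists>\<gamma>. geodesic_curve S' \<delta>' x \<gamma> y"
proof -
  assume xy: "x \<in> S'" "y \<in> S'"
  show ?thesis
  proof (cases rule: point_cases[OF xy(1)]; cases rule: point_cases[OF xy(2)])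
    assume S: "x \<in> S" "y \<in> S"
    then obtain \<gamma> where "geodesic_curve S \<delta> x \<gamma> y" using geodesic by blast
    then have "geodesic_curve S' \<delta>' x \<gamma> y"
      using S sub old unfolding geodesic_curve_def by (auto simp: \<delta>'_def image_subset_iff)
    then show ?thesis by blast
  next
    assume "\<pi> x = p" "h x \<in> {0..L}" "\<pi> y = p" "h y \<in> {0..L}"
    then show ?thesis
      using geodesic_segment[of x y] geodesic_segment[of y x] xy geodesic_curve_reverse[OF Metric_space', of y _ x]
      by (metis linear)
  next
    assume "x \<in> S" "\<pi> y = p" "h y \<in> {0..L}"
    then show ?thesis using geodesic_attach xy by blast
  next
    assume "y \<in> S" "\<pi> x = p" "h x \<in> {0..L}"
    then show ?thesis using geodesic_attach[of y x] xy geodesic_curve_reverse[OF Metric_space', of y _ x] by blast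
  qed
qed

end

section \<open>Metric trees\<close>

text \<open>Trees in the form suited to induction: each \<open>leaf\<close> step corresponds to
  attaching one segment to the metric space built so far.\<close>

inductive grown :: "'a set \<Rightarrow> 'a set set \<Rightarrow> bool" where
  single: "grown {r} {}"
| leaf: "grown V E \<Longrightarrow> v \<in> V \<Longrightarrow> l \<notin> V \<Longrightarrow> grown (insert l V) (insert {v, l} E)"

lemma grown_finite_graph: "grown V E \<Longrightarrow> finite_graph (V, E)"
proof (induction rule: grown.induct)
  case (leaf V E v l)
  then have "v \<noteq> l" by auto
  show ?case
    unfolding finite_graph_def fst_conv snd_conv
  proof (intro conjI ballI)
    show "finite (insert l V)" using leaf.IH by (simp add: finite_graph_def)
    fix e assume "e \<in> insert {v, l} E"
    then consider "e = {v, l}" | a b where "a \<in> V" "b \<in> V" "a \<noteq> b" "e = {a, b}"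
      using leaf.IH unfolding finite_graph_def by auto
    then show "\<exists>a\<in>insert l V. \<exists>b\<in>insert l V. a \<noteq> b \<and> e = {a, b}"
      by cases (use leaf.hyps(2) \<open>v \<noteq> l\<close> in blast)+
  qed
qed (simp add: finite_graph_def)

lemma grown_connected:
  assumes "grown V E"
  shows "connected_graph (V, E)"
proof -
  have "V \<noteq> {} \<and> (\<forall>a\<in>V. \<forall>b\<in>V. (adjacent E)\<^sup>*\<^sup>* a b)"
    using assms
  proof (induction rule: grown.induct)
    case (leaf V E v l)
    let ?E = "insert {v, l} E"
    have old: "(adjacent ?E)\<^sup>*\<^sup>* a b" if "a \<in> V" "b \<in> V" for a b
      using leaf.IH that by (auto intro: rtranclp_mono[THEN predicate2D, rotated])
    have to_v: "(adjacent ?E)\<^sup>*\<^sup>* a v" if "a \<in> insert l V" for a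
    proof (cases "a = l")
      case True
      then show ?thesis by (simp add: r_into_rtranclp insert_commute)
    next
      case False
      then show ?thesis using that old leaf.hyps by blast
    qed
    have "(adjacent ?E)\<^sup>*\<^sup>* a b" if "a \<in> insert l V" "b \<in> insert l V" for a b
      using rtranclp_trans[OF to_v[OF that(1)] adjacent_sym[OF to_v[OF that(2)]]] .
    then show ?case by blast
  qed simp
  then show ?thesis using connected_graph_iff_reach[OF grown_finite_graph[OF assms]] by simp
qed

lemma reach_crossing:
  assumes "(adjacent F)\<^sup>*\<^sup>* u v" "u \<in> S" "v \<notin> S"
  shows "\<exists>a b. a \<in> S \<and> b \<notin> S \<and> {a, b} \<in> F"
  using assms by (induction rule: rtranclp_induct) auto

text \<open>A maximal grown vertex set inside \<open>T\<close> is all of \<open>verts T\<close>, as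
  otherwise an edge leaving it would attach one more leaf. No edge is missed, since it would close a
  cycle.\<close>

lemma tree_graph_imp_grown:
  assumes "tree_graph T"
  shows "grown (verts T) (edges T)"
proof -
  have T: "finite_graph T" "connected_graph T" "\<And>p. \<not> graph_cycle T p"
    using assms by (auto simp: tree_graph_def)
  define A where "A = {S. S \<subseteq> verts T \<and> (\<exists>F. grown S F \<and> F \<subseteq> edges T)}"
  have "finite A" using T(1) by (simp add: A_def finite_graph_def)
  moreover obtain r where "r \<in> verts T" using T(2) by (auto simp: connected_graph_def)
  then have "{r} \<in> A" using grown.single[of r] by (auto simp: A_def)
  ultimately obtain S where S: "S \<in> A" and max: "\<And>S'. S' \<in> A \<Longrightarrow> S \<subseteq> S' \<Longrightarrow> S = S'"
    using finite_has_maximal2[of A "{r}"] by metis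
  then obtain F where F: "grown S F" "F \<subseteq> edges T" "S \<subseteq> verts T" by (auto simp: A_def)
  have "S \<noteq> {}" using grown_connected[OF F(1)] by (simp add: connected_graph_def)
  have "S = verts T"
  proof (rule ccontr)
    assume "S \<noteq> verts T"
    then obtain u v where "u \<in> S" "v \<in> verts T" "v \<notin> S" using F(3) \<open>S \<noteq> {}\<close> by blast
    then have "(adjacent (edges T))\<^sup>*\<^sup>* u v" using T(2) F(3) unfolding connected_graph_iff_reach[OF T(1)] by blast
    then obtain a b where ab: "a \<in> S" "b \<notin> S" "{a, b} \<in> edges T"
      using reach_crossing \<open>u \<in> S\<close> \<open>v \<notin> S\<close> by metis
    then have "b \<in> verts T" using finite_graph_edges_subset[OF T(1)] by blast
    then have "insert b S \<in> A"
      unfolding A_def using grown.leaf[OF F(1) ab(1,2)] F(2,3) ab(3) by blast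
    then show False using max[of "insert b S"] ab(2) by blast
  qed
  moreover have "edges T \<subseteq> F"
  proof
    fix e assume e: "e \<in> edges T"
    then obtain u v where uv: "u \<in> S" "v \<in> S" "u \<noteq> v" "e = {u, v}"
      using T(1) \<open>S = verts T\<close> unfolding finite_graph_def by blast
    \<comment> \<open>The path inside \<open>F\<close> and the edge \<open>e\<close> would form a
      cycle unless the path is \<open>e\<close> itself.\<close>
    then obtain p where p: "graph_path (S, F) u p v"
      using grown_connected[OF F(1)] by (auto simp: connected_graph_def)
    have "graph_path T u p v" using graph_path_mono[OF p] F by simp
    moreover have "hd p = u" "last p = v" using p by (simp_all add: graph_path_def)
    ultimately have "length p < 3"
      using T(3)[of p] e uv(4) by (simp add: graph_cycle_def insert_commute)
    then have "p = [u, v]" using p \<open>u \<noteq> v\<close>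
      by (cases p; cases "tl p"; cases "tl (tl p)") (auto simp: graph_path_def)
    then show "e \<in> F" using p uv(4) by (simp add: graph_path_Cons_Cons)
  qed
  ultimately show ?thesis using F by auto
qed

section \<open>Chains of segments and the explicit metric of a tree\<close>

definition point_step :: "'a graph \<Rightarrow> ('a set \<Rightarrow> real) \<Rightarrow> ('a \<Rightarrow> real) \<Rightarrow> real \<Rightarrow> ('a \<Rightarrow> real) \<Rightarrow> bool" where
  "point_step G w x c y \<longleftrightarrow>
     (\<exists>e\<in>edges G. x \<in> edge_points e \<and> y \<in> edge_points e \<and> c = segment_length w e x y)"

lemma segment_length_commute: "segment_length w e x y = segment_length w e y x"
  by (simp add: segment_length_def abs_minus_commute)

lemma point_step_commute: "point_step G w x c y \<Longrightarrow> point_step G w y c x"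
  unfolding point_step_def using segment_length_commute by metis

lemma weighted_chain_sym:
  assumes "\<And>x c y. R x c y \<Longrightarrow> R y c x" "weighted_chain R x i y"
  shows "weighted_chain R y i x"
  using assms(2)
proof (induction rule: weighted_chain.induct)
  case (step x c y i z)
  have "weighted_chain R y c x" by (rule weighted_chain_single) (rule assms(1)[OF step.hyps(1)])
  from weighted_chain_trans[OF step.IH this] show ?case by (simp add: add.commute)
qed (rule weighted_chain.refl)

lemma weighted_chain_mono:
  assumes "weighted_chain R x i y" "\<And>x c y. R x c y \<Longrightarrow> Q x c y"
  shows "weighted_chain Q x i y"
  using assms(1) by induction (auto intro: weighted_chain.intros assms(2))

lemma edge_points_doubleton:
  assumes "u \<noteq> v"
  shows "x \<in> edge_points {u, v} \<longleftrightarrow>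
    0 \<le> x u \<and> 0 \<le> x v \<and> x u + x v = 1 \<and> (\<forall>a. a \<noteq> u \<and> a \<noteq> v \<longrightarrow> x a = 0)"
  using assms unfolding edge_points_def by simp (metis order.refl)

text \<open>Applied to a newly attached leaf, this says that old points have coordinate 0 there,
  hence height 0.\<close>

lemma graph_points_support:
  assumes "x \<in> graph_points G" "\<Union>(edges G) \<subseteq> verts G" "a \<notin> verts G"
  shows "x a = 0"
  using assms by (auto simp: graph_points_def vertex_point_def edge_points_def)

lemma edge_points_subset_graph_points: "e \<in> edges G \<Longrightarrow> edge_points e \<subseteq> graph_points G"
  by (auto simp: graph_points_def)

text \<open>Together with the triangle inequality, the two conditions identify \<open>\<delta>\<close> with the infimum of
  the lengths of all chains of segments: the first makes it a lower bound, the second an attained one.\<close>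

definition length_metric :: "'a graph \<Rightarrow> ('a set \<Rightarrow> real) \<Rightarrow> (('a \<Rightarrow> real) \<Rightarrow> ('a \<Rightarrow> real) \<Rightarrow> real) \<Rightarrow> bool" where
  "length_metric G w \<delta> \<longleftrightarrow>
     (\<forall>e\<in>edges G. \<forall>x\<in>edge_points e. \<forall>y\<in>edge_points e. \<delta> x y = segment_length w e x y) \<and>
     (\<forall>x\<in>graph_points G. \<forall>y\<in>graph_points G. weighted_chain (point_step G w) x (\<delta> x y) y)"

text \<open>The distance is built explicitly along the growth of the tree instead of as an infimum.
  Geodesics and the four-point condition are then inherited from \<open>attached_segment\<close>,
  while \<open>length_metric\<close> keeps the link to the infimum over chains.\<close>

lemma grown_length_metric:
  assumes "grown V E" "\<forall>e\<in>E. 0 < w e"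
  shows "\<exists>\<delta>. geodesic_space (graph_points (V, E)) \<delta> \<and> four_point (graph_points (V, E)) \<delta> \<and>
    length_metric (V, E) w \<delta>"
  using assms
proof (induction rule: grown.induct)
  case (single r)
  have "graph_points ({r}, {}) = {vertex_point r}" by (simp add: graph_points_def)
  moreover have "geodesic_space {vertex_point r} (\<lambda>_ _. 0)"
    by (auto simp: geodesic_space_def geodesic_curve_def Metric_space_def)
  ultimately show ?case
    by (intro exI[of _ "\<lambda>_ _. 0"]) (simp add: four_point_def length_metric_def weighted_chain.refl)
next
  case (leaf V E v l)
  then obtain \<delta> where geo: "geodesic_space (graph_points (V, E)) \<delta>"
    and four: "four_point (graph_points (V, E)) \<delta>" and len: "length_metric (V, E) w \<delta>"
    by auto
  let ?S = "graph_points (V, E)" and ?G = "(insert l V, insert {v, l} E)"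
  let ?S' = "graph_points ?G" and ?e = "{v, l}" and ?p = "vertex_point v"
  have vl: "v \<noteq> l" "l \<noteq> v" using leaf.hyps by auto
  note ep = edge_points_doubleton[OF vl(1)]
  define L where "L = w ?e"
  have L: "0 < L" using leaf.prems by (simp add: L_def)
  have vp: "?p \<in> ?S" "?p \<in> edge_points ?e"
    using leaf.hyps by (auto simp: graph_points_def ep) (auto simp: vertex_point_def vl)
  have S': "?S' = ?S \<union> edge_points ?e"
  proof -
    have "vertex_point l \<in> edge_points ?e" by (auto simp: ep vertex_point_def vl)
    then show ?thesis by (auto simp: graph_points_def)
  qed
  have supp: "x l = 0" if "x \<in> ?S" for x
    using graph_points_support[OF that] finite_graph_edges_subset[OF grown_finite_graph[OF leaf.hyps(1)]]
      leaf.hyps(3) by simp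
  \<comment> \<open>In barycentric coordinates, \<pi> moves the mass at the leaf \<open>l\<close> to
    \<open>v\<close>, and \<open>h\<close> is the mass at \<open>l\<close> scaled by the edge
    length. The point of height \<open>t\<close> on the new edge is
    \<open>\<sigma> t\<close>.\<close>
  define \<pi> :: "('a \<Rightarrow> real) \<Rightarrow> 'a \<Rightarrow> real" where "\<pi> x = x(l := 0, v := x v + x l)" for x
  define h :: "('a \<Rightarrow> real) \<Rightarrow> real" where "h x = L * x l" for x
  define \<sigma> :: "real \<Rightarrow> 'a \<Rightarrow> real" where "\<sigma> t = (\<lambda>u. if u = l then t / L else if u = v then 1 - t / L else 0)" for t
  have old: "\<pi> x = x \<and> h x = 0" if "x \<in> ?S" for x
    using supp[OF that] by (auto simp: \<pi>_def h_def fun_eq_iff)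
  have on_seg: "\<pi> x = ?p \<and> h x \<in> {0..L}" if "x \<in> edge_points ?e" for x
  proof -
    have x: "0 \<le> x v" "0 \<le> x l" "x v + x l = 1" "\<And>a. a \<noteq> v \<Longrightarrow> a \<noteq> l \<Longrightarrow> x a = 0"
      using that by (simp_all add: ep)
    then have "x l \<le> 1" by linarith
    then show ?thesis using x L by (auto simp: \<pi>_def h_def vertex_point_def fun_eq_iff)
  qed
  interpret attached_segment ?S \<delta> ?S' ?p \<pi> h \<sigma> L
  proof (unfold_locales)
    show "\<And>x y. 0 \<le> \<delta> x y" "\<And>x y. \<delta> x y = \<delta> y x"
      "\<And>x y. x \<in> ?S \<Longrightarrow> y \<in> ?S \<Longrightarrow> \<delta> x y = 0 \<longleftrightarrow> x = y"
      "\<And>x y z. x \<in> ?S \<Longrightarrow> y \<in> ?S \<Longrightarrow> z \<in> ?S \<Longrightarrow> \<delta> x z \<le> \<delta> x y + \<delta> y z"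
      using geo by (auto simp: geodesic_space_def Metric_space_def)
    show "\<And>x y. x \<in> ?S \<Longrightarrow> y \<in> ?S \<Longrightarrow> \<exists>\<gamma>. geodesic_curve ?S \<delta> x \<gamma> y"
      using geo by (auto simp: geodesic_space_def)
    show "\<And>x. x \<in> ?S' - ?S \<Longrightarrow> \<pi> x = ?p \<and> h x \<in> {0..L}" using on_seg S' by blast
    show "\<sigma> t \<in> ?S' \<and> \<pi> (\<sigma> t) = ?p \<and> h (\<sigma> t) = t" if "t \<in> {0..L}" for t
    proof -
      have "\<sigma> t \<in> edge_points ?e" using that L vl by (simp add: ep \<sigma>_def)
      then show ?thesis using on_seg S' L by (auto simp: h_def \<sigma>_def)
    qed
    show "x = y" if "\<pi> x = \<pi> y" "h x = h y" for x y
    proof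
      fix u
      have "x l = y l" using that(2) L by (simp add: h_def)
      then show "x u = y u" using fun_cong[OF that(1), of u] vl by (simp add: \<pi>_def split: if_splits)
    qed
  qed (use four vp old S' in auto)
  have seg: "\<delta>' x y = segment_length w ?e x y" if "x \<in> edge_points ?e" "y \<in> edge_points ?e" for x y
  proof -
    have "x v = 1 - x l" "y v = 1 - y l" using that by (simp_all add: ep eq_diff_eq)
    then have "(\<Sum>a\<in>?e. \<bar>x a - y a\<bar>) = 2 * \<bar>x l - y l\<bar>" using vl by simp
    then have "segment_length w ?e x y = \<bar>h x - h y\<bar>"
      using L by (simp add: segment_length_def h_def abs_mult flip: L_def right_diff_distrib)
    then show ?thesis using on_seg that vp by (simp add: \<delta>'_def)
  qed
  have chain_old: "weighted_chain (point_step ?G w) x (\<delta>' x y) y" if "x \<in> ?S" "y \<in> ?S" for x y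
  proof -
    have "weighted_chain (point_step (V, E) w) x (\<delta>' x y) y"
      using len old that by (simp add: length_metric_def \<delta>'_def)
    then show ?thesis by (rule weighted_chain_mono) (auto simp: point_step_def)
  qed
  have chain_new: "weighted_chain (point_step ?G w) x (\<delta>' x y) y"
    if "x \<in> edge_points ?e" "y \<in> edge_points ?e" for x y
    using that seg[OF that] by (intro weighted_chain_single) (auto simp: point_step_def)
  have chain_mixed: "weighted_chain (point_step ?G w) x (\<delta>' x y) y" if "x \<in> ?S" "y \<in> edge_points ?e" for x y
  proof -
    \<comment> \<open>The distance is additive at the attaching point, so an old chain up to it and
      one segment beyond it have the right total.\<close>
    have "\<delta>' x y = \<delta>' x ?p + \<delta>' ?p y" using old on_seg that vp by (simp add: \<delta>'_def)
    then show ?thesis using weighted_chain_trans[OF chain_old chain_new] that vp by metis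
  qed
  have chain: "weighted_chain (point_step ?G w) x (\<delta>' x y) y" if "x \<in> ?S'" "y \<in> ?S'" for x y
  proof -
    have "weighted_chain (point_step ?G w) x (\<delta>' x y) y" if "y \<in> ?S" "x \<in> edge_points ?e"
      using weighted_chain_sym[OF point_step_commute chain_mixed[OF that]] by (simp add: \<delta>'_def commute abs_minus_commute)
    then show ?thesis using that chain_old chain_new chain_mixed unfolding S' by blast
  qed
  have "\<delta>' x y = segment_length w e x y" if "e \<in> insert ?e E" "x \<in> edge_points e" "y \<in> edge_points e" for e x y
  proof (cases "e = ?e")
    case False
    then have "x \<in> ?S" "y \<in> ?S" "e \<in> E" using that edge_points_subset_graph_points[of e "(V, E)"] by auto
    then show ?thesis using len old that by (simp add: length_metric_def \<delta>'_def)
  qed (use that seg in simp)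
  then have "length_metric ?G w \<delta>'" using chain by (simp add: length_metric_def)
  moreover have "geodesic_space ?S' \<delta>'" using Metric_space' geodesic' by (simp add: geodesic_space_def)
  ultimately show ?case using four_point' by blast
qed

section \<open>The metric \<open>d\<^sub>\<alpha>\<close>\<close>

lemma point_path_Nil: "point_path G x xs [] y \<longleftrightarrow> xs = [x] \<and> x = y \<and> x \<in> graph_points G"
  by (auto simp: point_path_def length_Suc_conv)

lemma point_path_Cons:
  "point_path G x xs (e # es) y \<longleftrightarrow>
     (\<exists>z zs. xs = x # z # zs \<and> x \<in> graph_points G \<and> e \<in> edges G \<and> x \<in> edge_points e \<and> z \<in> edge_points e \<and>
        point_path G z (z # zs) es y)"
  by (cases xs; cases "tl xs") (auto simp: point_path_def All_less_Suc2)

lemma path_integral_Cons: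
  "path_integral d \<alpha> (x # z # zs) (e # es) =
     d e powr - \<alpha> * segment_length d e x z + path_integral d \<alpha> (z # zs) es"
  unfolding path_integral_def by (simp add: sum.lessThan_Suc_shift del: sum.lessThan_Suc)

text \<open>Multiplying the density \<open>d e powr - \<alpha>\<close> by the length
  \<open>d e\<close> gives \<open>d e powr (1 - \<alpha>)\<close>, so path integrals for
  \<open>d\<close> are ordinary lengths for the edge weights of the rescaled graph.\<close>

lemma powr_segment_length:
  assumes "0 < d e"
  shows "d e powr - \<alpha> * segment_length d e x y = segment_length (\<lambda>e. d e powr (1 - \<alpha>)) e x y"
  using powr_mult_base[of "d e" "- \<alpha>"] assms by (simp add: segment_length_def mult_ac)

lemma point_path_imp_chain:
  assumes "point_path G x xs es y" "\<forall>e\<in>edges G. 0 < d e"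
  shows "weighted_chain (point_step G (\<lambda>e. d e powr (1 - \<alpha>))) x (path_integral d \<alpha> xs es) y"
  using assms
proof (induction es arbitrary: x xs)
  case Nil
  then show ?case by (auto simp: point_path_Nil path_integral_def intro: weighted_chain.refl)
next
  case (Cons e es)
  then obtain z zs where z: "xs = x # z # zs" "e \<in> edges G" "x \<in> edge_points e" "z \<in> edge_points e"
    "point_path G z (z # zs) es y" by (auto simp: point_path_Cons)
  then show ?case
    using Cons by (auto simp: path_integral_Cons powr_segment_length point_step_def intro!: weighted_chain.step)
qed

text \<open>With \<open>point_path_imp_chain\<close>, this identifies the path integrals with the
  weights of chains. That \<open>y\<close> is a point of the graph serves the empty chain, whose
  one-point path must lie in the graph.\<close>

lemma chain_imp_point_path:
  assumes "weighted_chain (point_step G (\<lambda>e. d e powr (1 - \<alpha>))) x i y" "y \<in> graph_points G"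
    "\<forall>e\<in>edges G. 0 < d e"
  shows "\<exists>xs es. point_path G x xs es y \<and> path_integral d \<alpha> xs es = i"
  using assms
proof (induction rule: weighted_chain.induct)
  case (refl x)
  then show ?case by (intro exI[of _ "[x]"] exI[of _ "[]"]) (simp add: point_path_Nil path_integral_def)
next
  case (step x c z i y)
  then obtain xs es where p: "point_path G z xs es y" "path_integral d \<alpha> xs es = i" by blast
  obtain e where e: "e \<in> edges G" "x \<in> edge_points e" "z \<in> edge_points e"
    "c = d e powr - \<alpha> * segment_length d e x z"
    using step.hyps(1) step.prems by (auto simp: point_step_def powr_segment_length)
  obtain zs where zs: "xs = z # zs" using p(1) by (cases xs) (auto simp: point_path_def)
  have "x \<in> graph_points G" using e edge_points_subset_graph_points by blast
  then have "point_path G x (x # xs) (e # es) y" using p e zs by (simp add: point_path_Cons)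
  moreover have "path_integral d \<alpha> (x # xs) (e # es) = c + i" using p e zs by (simp add: path_integral_Cons)
  ultimately show ?case by blast
qed

lemma graph_dist_eq_length_metric:
  assumes met: "Metric_space (graph_points G) \<delta>" and len: "length_metric G (\<lambda>e. d e powr (1 - \<alpha>)) \<delta>"
    and pos: "\<forall>e\<in>edges G. 0 < d e" and xy: "x \<in> graph_points G" "y \<in> graph_points G"
  shows "graph_dist G d \<alpha> x y = \<delta> x y"
proof -
  interpret Metric_space "graph_points G" \<delta> by fact
  \<comment> \<open>Each step of a chain costs exactly the \<delta>-distance of its ends, so the
    triangle inequality adds up along the chain.\<close>
  have lower: "\<delta> x y \<le> i"
    if "weighted_chain (point_step G (\<lambda>e. d e powr (1 - \<alpha>))) x i y" "y \<in> graph_points G" "x \<in> graph_points G" for x i y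
    using that
  proof (induction rule: weighted_chain.induct)
    case (step x c z i y)
    then have "\<delta> x z = c" "z \<in> graph_points G"
      using len edge_points_subset_graph_points[of _ G] by (auto simp: point_step_def length_metric_def)
    then show ?case using step triangle[of x z y] by simp
  qed simp
  have "Inf {path_integral d \<alpha> xs es |xs es. point_path G x xs es y} = \<delta> x y"
  proof (rule cInf_eq_minimum)
    \<comment> \<open>The infimum is attained by the chain of weight \<open>\<delta> x y\<close>
      that \<open>length_metric\<close> provides.\<close>
    show "\<delta> x y \<in> {path_integral d \<alpha> xs es |xs es. point_path G x xs es y}"
      using chain_imp_point_path[OF _ xy(2) pos, of \<alpha> x "\<delta> x y"] len xy
      unfolding length_metric_def by (smt (verit) mem_Collect_eq)
  qed (use point_path_imp_chain[OF _ pos] lower xy in blast)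
  then show ?thesis using xy by (simp add: graph_dist_def)
qed

section \<open>Transfer to the infimum metric and conclusion\<close>

lemma geodesic_space_cong:
  assumes geo: "geodesic_space S \<delta>" and eq: "\<And>x y. x \<in> S \<Longrightarrow> y \<in> S \<Longrightarrow> \<delta>' x y = \<delta> x y"
    and "\<And>x y. 0 \<le> \<delta>' x y" "\<And>x y. \<delta>' x y = \<delta>' y x"
  shows "geodesic_space S \<delta>'"
proof -
  have "Metric_space S \<delta>'" using geo assms(3,4) eq by (auto simp: geodesic_space_def Metric_space_def)
  moreover have "\<exists>\<gamma>. geodesic_curve S \<delta>' x \<gamma> y" if "x \<in> S" "y \<in> S" for x y
  proof -
    obtain \<gamma> where "geodesic_curve S \<delta> x \<gamma> y" using geo \<open>x \<in> S\<close> \<open>y \<in> S\<close> by (auto simp: geodesic_space_def)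
    then have "geodesic_curve S \<delta>' x \<gamma> y"
      using that eq by (simp add: geodesic_curve_def image_subset_iff)
    then show ?thesis by blast
  qed
  ultimately show ?thesis by (simp add: geodesic_space_def)
qed

text \<open>No restriction on \<alpha> arises, as all powers of positive weights are positive. The
  explicit metric agrees with \<open>graph_dist\<close> on the points of the tree, so its geodesics
  and the four-point condition carry over.\<close>

lemma CAT0_tree:
  assumes tree: "tree_graph T" and pos: "\<forall>e\<in>edges T. 0 < d e"
  shows "CAT0 (graph_points T) (graph_dist T d \<alpha>)"
proof -
  have "\<forall>e\<in>edges T. 0 < d e powr (1 - \<alpha>)" using pos by auto
  from grown_length_metric[OF tree_graph_imp_grown[OF tree] this]
  obtain \<delta> where geo: "geodesic_space (graph_points T) \<delta>" and four: "four_point (graph_points T) \<delta>"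
    and len: "length_metric T (\<lambda>e. d e powr (1 - \<alpha>)) \<delta>" by auto
  have met: "Metric_space (graph_points T) \<delta>" using geo by (simp add: geodesic_space_def)
  note eq = graph_dist_eq_length_metric[OF met len pos]
  \<comment> \<open>The default value 0 gives nonnegativity and symmetry off the graph, where
    \<open>Metric_space\<close> demands them too.\<close>
  have out: "graph_dist T d \<alpha> x y = 0" if "\<not> (x \<in> graph_points T \<and> y \<in> graph_points T)" for x y
    using that by (auto simp: graph_dist_def)
  have "0 \<le> graph_dist T d \<alpha> x y" "graph_dist T d \<alpha> x y = graph_dist T d \<alpha> y x" for x y
    using eq[of x y] eq[of y x] out[of x y] out[of y x] Metric_space.nonneg[OF met] Metric_space.commute[OF met]
    by (metis order.refl)+
  then have "geodesic_space (graph_points T) (graph_dist T d \<alpha>)"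
    using geodesic_space_cong[OF geo eq] by blast
  moreover have "four_point (graph_points T) (graph_dist T d \<alpha>)"
    using four by (simp add: four_point_def eq)
  ultimately show ?thesis by (rule CAT0_if_four_point)
qed

theorem corollary3p3:
  fixes G :: "'a graph" and d :: "'a set \<Rightarrow> real"
  assumes "finite_graph G" and "connected_graph G"
    and "\<forall>e\<in>edges G. 0 < d e" and "inj_on d (edges G)"
  shows "(\<exists>!T. minimum_spanning_tree G d T) \<and>
    (\<exists>\<alpha>s::real. \<forall>\<alpha>\<le>\<alpha>s.
       geodesic_subgraph G (\<lambda>e. d e powr (1 - \<alpha>)) = the_mst G d \<and>
       CAT0 (graph_points (geodesic_subgraph G (\<lambda>e. d e powr (1 - \<alpha>))))
            (graph_dist (geodesic_subgraph G (\<lambda>e. d e powr (1 - \<alpha>))) d \<alpha>))"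
proof -
  obtain \<alpha>s where \<alpha>s: "\<And>\<alpha> T. \<alpha> \<le> \<alpha>s \<Longrightarrow> minimum_spanning_tree G d T \<Longrightarrow>
      geodesic_subgraph G (\<lambda>e. d e powr (1 - \<alpha>)) = T"
    using geodesic_subgraph_eq_mst[OF assms(1,3,4)] by blast
  obtain T where T: "minimum_spanning_tree G d T" using minimum_spanning_tree_exists[OF assms(1,2)] by blast
  \<comment> \<open>At the threshold both trees equal the same geodesic sub-graph.\<close>
  have unique: "T' = T" if "minimum_spanning_tree G d T'" for T'
    using \<alpha>s[OF order.refl that] \<alpha>s[OF order.refl T] by simp
  have "the_mst G d = T" unfolding the_mst_def using T unique by (rule the_equality)
  moreover have "tree_graph T" "\<forall>e\<in>edges T. 0 < d e"
    using T assms(3) by (auto simp: minimum_spanning_tree_def spanning_tree_def)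
  then have "CAT0 (graph_points T) (graph_dist T d \<alpha>)" for \<alpha> by (rule CAT0_tree)
  ultimately show ?thesis using T unique \<alpha>s by metis
qed

end
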